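(* Let $J\colon\mathbb{R}^2\to\mathbb{R}^2$ be the rotation $J(u,v)=(-v,u)$, and let $A=\gamma J$, $B=J$ with $\gamma\ge0$. The iterates of the forward-reflected-backward method $$x_{k+1}=(I+\lambda A)^{-1}\bigl(x_k-2\lambda B(x_k)+\lambda B(x_{k-1})\bigr)$$ converge to the unique solution $x_\star=0$ of $0=Ax+Bx$ for every $\lambda\in(0,\lambda^\star(\gamma))$ and diverge for $\lambda>\lambda^\star(\gamma)$, where $$\lambda^\star(\gamma)=\frac{1}{L\sqrt{(1+\gamma)(3-\gamma)}}\quad(0\le\gamma<3),\qquad \lambda^\star(\gamma)=+\infty\quad(\gamma\ge 3),$$ with the convention $L=1$ for $B=J$. In particular $\lambda^\star(0)=1/\sqrt3$ (the reflected-gradient constant), the minimum over $\gamma\ge0$ is $\lambda^\star(1)=\tfrac12$, and $\lambda^\star(2)=1/\sqrt3$.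
   Context: The iteration is started from initial points $x_0,x_{-1}\in\mathbb{R}^2$ and run with a fixed step size $\lambda>0$. $L$ denotes the Lipschitz constant of $B$, which equals $1$ for $B=J$.
   Formalization: Divergence for λ > λ*(γ) is stated for all initial points (x_{-1}, x_0) outside some proper linear subspace of R^2 × R^2 (which may depend on γ and λ), where the norm of x_k tends to infinity; it cannot hold for all initial points, since x_{-1} = x_0 = 0 stays at 0. *)

theory Defs
  imports "HOL-Analysis.Analysis"
begin

definition rotJ :: "real^2 \<Rightarrow> real^2" where
  "rotJ x = vector [- x $ 2, x $ 1]"

text \<open>The best (smallest) Lipschitz constant; meaningful for globally Lipschitz maps.\<close>

definition lipschitz_const :: "('a::metric_space \<Rightarrow> 'b::metric_space) \<Rightarrow> real" where
  "lipschitz_const f = Inf {C. C-lipschitz_on UNIV f}"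

text \<open>The resolvent \<open>(I + \<lambda>A)\<^sup>-\<^sup>1\<close> of a single-valued operator.
  The use of \<^term>\<open>inv\<close> is only meaningful when \<open>I + \<lambda>A\<close> is bijective; for the
  operators \<open>A = \<gamma>J\<close> this is lemma \<open>bij_I_plus_rotJ\<close> below.\<close>

definition resolvent :: "real \<Rightarrow> ('a::real_vector \<Rightarrow> 'a) \<Rightarrow> 'a \<Rightarrow> 'a" where
  "resolvent lam A = inv (\<lambda>x. x + lam *\<^sub>R A x)"

text \<open>Indices are shifted by one: \<open>frb A B lam xm x0 n\<close> is the iterate \<open>x\<^bsub>n-1\<^esub>\<close>,
  so that the starting points \<open>x\<^bsub>-1\<^esub>\<close> and \<open>x\<^bsub>0\<^esub>\<close> sit at positions 0 and 1.\<close>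

fun frb :: "('a::real_vector \<Rightarrow> 'a) \<Rightarrow> ('a \<Rightarrow> 'a) \<Rightarrow> real \<Rightarrow> 'a \<Rightarrow> 'a \<Rightarrow> nat \<Rightarrow> 'a" where
  "frb A B lam xm x0 0 = xm"
| "frb A B lam xm x0 (Suc 0) = x0"
| "frb A B lam xm x0 (Suc (Suc k)) =
     resolvent lam A
       (frb A B lam xm x0 (Suc k)
         - (2 * lam) *\<^sub>R B (frb A B lam xm x0 (Suc k))
         + lam *\<^sub>R B (frb A B lam xm x0 k))"

definition lambda_star :: "real \<Rightarrow> real \<Rightarrow> ereal" where
  "lambda_star L \<gamma> =
     (if \<gamma> < 3 then ereal (1 / (L * sqrt ((1 + \<gamma>) * (3 - \<gamma>)))) else \<infinity>)"

lemma bij_I_plus_rotJ: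
  fixes lam \<gamma> :: real
  shows "bij (\<lambda>x. x + lam *\<^sub>R (\<gamma> *\<^sub>R rotJ x))"
proof -
  let ?f = "\<lambda>x::real^2. x + lam *\<^sub>R (\<gamma> *\<^sub>R rotJ x)"
  have lin: "linear ?f"
    by (rule linearI) (simp_all add: rotJ_def vec_eq_iff forall_2 algebra_simps)
  have "inj ?f"
    unfolding linear_injective_0[OF lin]
  proof (intro allI impI)
    fix x :: "real^2"
    define c where "c = lam * \<gamma>"
    assume "?f x = 0"
    then have "x $ 1 - c * x $ 2 = 0 \<and> x $ 2 + c * x $ 1 = 0"
      by (auto simp: rotJ_def vec_eq_iff forall_2 c_def mult.assoc)
    then have "x $ 1 * x $ 1 + x $ 2 * x $ 2 = 0"
      by algebra
    then show "x = 0"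
      by (simp add: vec_eq_iff forall_2 sum_squares_eq_zero_iff)
  qed
  then show ?thesis
    using lin by (simp add: bij_def linear_injective_imp_surjective)
qed

end

theory Submission
  imports Defs
begin

text \<open>Identify \<open>real^2\<close> with the complex plane, so that \<open>J\<close> is multiplication by \<open>\<i>\<close>.
  The method becomes the scalar recurrence
  \<open>(1 + \<i>\<lambda>\<gamma>) z'' = (1 - 2\<i>\<lambda>) z' + \<i>\<lambda> z\<close>. With \<open>s\<close> and \<open>p\<close> the sum and the product of its
  characteristic roots \<open>r\<close>, \<open>q\<close>, the Schur--Cohn identity
  \<open>(1 - |p|\<^sup>2)\<^sup>2 - |s - p s*|\<^sup>2 = (1 - |r|\<^sup>2) (1 - |q|\<^sup>2) |1 - r q*|\<^sup>2\<close>
  has a left-hand side which here is a positive multiple of \<open>1 - \<lambda>\<^sup>2 (1 + \<gamma>) (3 - \<gamma>)\<close>.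
  Below the threshold both roots lie in the open unit disc; above it exactly one does, and the
  iterates escape unless the component along the other root vanishes.\<close>

section \<open>The plane as the complex numbers; Lipschitz constant and zeros of the
  rotation\<close>

definition complex_of_vec :: "real^2 \<Rightarrow> complex" where
  "complex_of_vec x = Complex (x $ 1) (x $ 2)"

lemma linear_complex_of_vec: "linear complex_of_vec"
  by (rule linearI) (simp_all add: complex_of_vec_def complex_eq_iff)

lemma norm_complex_of_vec: "norm (complex_of_vec x) = norm x"
  by (simp add: complex_of_vec_def cmod_def norm_vec_def L2_set_def sum_2)

lemma complex_of_vec_rotJ: "complex_of_vec (rotJ x) = \<i> * complex_of_vec x"
  by (simp add: complex_of_vec_def rotJ_def complex_eq_iff)

lemma norm_rotJ: "norm (rotJ x) = norm x"
  by (metis complex_of_vec_rotJ norm_complex_of_vec norm_ii norm_mult mult_1)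

lemma rotJ_diff: "rotJ x - rotJ y = rotJ (x - y)"
  by (simp add: rotJ_def vec_eq_iff forall_2)

text \<open>The rotation is an isometry, so 1 is admissible, and the single pair
  \<open>axis 1 1\<close>, \<open>0\<close> at distance 1 already excludes every smaller
  constant.\<close>

lemma lipschitz_const_rotJ: "lipschitz_const rotJ = 1"
  unfolding lipschitz_const_def
proof (rule cInf_eq_minimum)
  show "1 \<in> {C. C-lipschitz_on UNIV rotJ}"
    by (auto intro!: lipschitz_onI simp: dist_norm rotJ_diff norm_rotJ)
next
  fix C assume "C \<in> {C. C-lipschitz_on UNIV rotJ}"
  then have "C-lipschitz_on UNIV rotJ"
    by simp
  then have "dist (rotJ (axis 1 1)) (rotJ 0) \<le> C * dist (axis 1 1 :: real^2) 0"
    by (rule lipschitz_onD) auto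
  then show "1 \<le> C"
    by (simp add: dist_norm rotJ_diff norm_rotJ)
qed

lemma rotJ_zeros:
  assumes "\<gamma> \<ge> 0"
  shows "{x. 0 = \<gamma> *\<^sub>R rotJ x + rotJ x} = {0}"
proof -
  have "\<gamma> *\<^sub>R rotJ x + rotJ x = (\<gamma> + 1) *\<^sub>R rotJ x" for x
    by (simp add: scaleR_left_distrib)
  moreover have "rotJ x = 0 \<longleftrightarrow> x = 0" for x
    by (metis norm_rotJ norm_eq_zero)
  ultimately show ?thesis
    using assms by (auto simp: eq_commute[of 0])
qed

section \<open>Reduction of the method to a complex scalar recurrence\<close>

lemma resolvent_rotJ:
  fixes lam \<gamma> :: real and v :: "real^2"
  defines "y \<equiv> resolvent lam (\<lambda>x. \<gamma> *\<^sub>R rotJ x) v"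
  shows "y + lam *\<^sub>R (\<gamma> *\<^sub>R rotJ y) = v"
  unfolding y_def resolvent_def
  by (rule surj_f_inv_f[OF bij_is_surj[OF bij_I_plus_rotJ]])

text \<open>The index shift of \<open>frb\<close> is kept: positions 0 and 1 hold the starting
  points x_{-1} and x_0.\<close>

definition frb_complex :: "real \<Rightarrow> real \<Rightarrow> real^2 \<Rightarrow> real^2 \<Rightarrow> nat \<Rightarrow> complex" where
  "frb_complex \<gamma> lam xm x0 n = complex_of_vec (frb (\<lambda>x. \<gamma> *\<^sub>R rotJ x) rotJ lam xm x0 n)"

lemma norm_frb_complex: "norm (frb_complex \<gamma> lam xm x0 n) = norm (frb (\<lambda>x. \<gamma> *\<^sub>R rotJ x) rotJ lam xm x0 n)"
  by (simp add: frb_complex_def norm_complex_of_vec)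

text \<open>The resolvent enters only through its implicit equation \<open>resolvent_rotJ\<close>,
  which is why the leading coefficient stays on the left and no inverse of I + lam A is
  computed.\<close>

lemma frb_complex_recurrence:
  "(1 + \<i> * (lam * \<gamma>)) * frb_complex \<gamma> lam xm x0 (Suc (Suc n))
    = (1 - 2 * \<i> * lam) * frb_complex \<gamma> lam xm x0 (Suc n) + \<i> * lam * frb_complex \<gamma> lam xm x0 n"
proof -
  let ?x = "frb (\<lambda>x. \<gamma> *\<^sub>R rotJ x) rotJ lam xm x0"
  have "?x (Suc (Suc n)) + lam *\<^sub>R (\<gamma> *\<^sub>R rotJ (?x (Suc (Suc n))))
      = ?x (Suc n) - (2 * lam) *\<^sub>R rotJ (?x (Suc n)) + lam *\<^sub>R rotJ (?x n)"
    unfolding frb.simps by (rule resolvent_rotJ)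
  from arg_cong[OF this, of complex_of_vec]
  have "frb_complex \<gamma> lam xm x0 (Suc (Suc n))
      + lam *\<^sub>R (\<gamma> *\<^sub>R (\<i> * frb_complex \<gamma> lam xm x0 (Suc (Suc n))))
    = frb_complex \<gamma> lam xm x0 (Suc n) - (2 * lam) *\<^sub>R (\<i> * frb_complex \<gamma> lam xm x0 (Suc n))
      + lam *\<^sub>R (\<i> * frb_complex \<gamma> lam xm x0 n)"
    by (simp only: frb_complex_def linear_add[OF linear_complex_of_vec]
        linear_diff[OF linear_complex_of_vec] linear_scale[OF linear_complex_of_vec]
        complex_of_vec_rotJ)
  then show ?thesis
    by (simp add: scaleR_conv_of_real algebra_simps)
qed

section \<open>Second-order linear recurrences with prescribed characteristic roots\<close>

definition recurrence_with_roots :: "'a::comm_ring_1 \<Rightarrow> 'a \<Rightarrow> (nat \<Rightarrow> 'a) \<Rightarrow> bool" where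
  "recurrence_with_roots r q z \<longleftrightarrow> (\<forall>n. z (Suc (Suc n)) = (r + q) * z (Suc n) - r * q * z n)"

text \<open>Lets the roots exchange roles: it supplies the second first-order identity in
  \<open>recurrence_at_infinity\<close> and the case of a large \<open>q\<close> in
  \<open>frb_rotJ_diverges\<close>.\<close>

lemma recurrence_with_roots_commute:
  "recurrence_with_roots r q z \<longleftrightarrow> recurrence_with_roots q r z"
  by (simp add: recurrence_with_roots_def add.commute mult.commute)

lemma quadratic_roots_exist:
  fixes s p :: complex
  obtains r q where "r + q = s" "r * q = p"
proof -
  let ?d = "csqrt (s\<^sup>2 - 4 * p)"
  have "?d * ?d = s\<^sup>2 - 4 * p"
    by (metis power2_csqrt power2_eq_square)
  then have "(s + ?d) / 2 + (s - ?d) / 2 = s" "(s + ?d) / 2 * ((s - ?d) / 2) = p"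
    by (simp_all add: field_simps power2_eq_square)
  then show ?thesis
    by (rule that)
qed

lemma power2_gt_1_iff:
  fixes x :: real
  assumes "x \<ge> 0"
  shows "1 < x\<^sup>2 \<longleftrightarrow> 1 < x"
  using assms by (metis abs_of_nonneg abs_square_le_1 not_le)

text \<open>With |w|^2 written as w times its conjugate, this is a polynomial identity in r, q and
  their conjugates, checked in the complex numbers and pulled back to the reals. The left side
  involves only the sum and product of the roots, so the position of the roots can be judged without
  solving the quadratic.\<close>

lemma schur_cohn_identity:
  fixes r q :: complex
  shows "(1 - (cmod (r * q))\<^sup>2)\<^sup>2 - (cmod (r + q - r * q * cnj (r + q)))\<^sup>2
       = (1 - (cmod r)\<^sup>2) * (1 - (cmod q)\<^sup>2) * (cmod (1 - r * cnj q))\<^sup>2"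
proof -
  have "(1 - r * q * cnj (r * q))\<^sup>2 - (r + q - r * q * cnj (r + q)) * cnj (r + q - r * q * cnj (r + q))
      = (1 - r * cnj r) * (1 - q * cnj q) * ((1 - r * cnj q) * cnj (1 - r * cnj q))"
    by (simp add: power2_eq_square algebra_simps)
  then have "of_real ((1 - (cmod (r * q))\<^sup>2)\<^sup>2 - (cmod (r + q - r * q * cnj (r + q)))\<^sup>2)
       = complex_of_real ((1 - (cmod r)\<^sup>2) * (1 - (cmod q)\<^sup>2) * (cmod (1 - r * cnj q))\<^sup>2)"
    by (simp only: of_real_diff of_real_mult of_real_1 of_real_power flip: complex_norm_square)
  then show ?thesis
    by (simp only: of_real_eq_iff)
qed

text \<open>With E the shift, the recurrence reads (E - r)(E - q) z = 0, so (E - q) z is geometric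
  with ratio r. Nothing here requires r and q to differ.\<close>

lemma recurrence_first_order:
  fixes z :: "nat \<Rightarrow> 'a::comm_ring_1"
  assumes "recurrence_with_roots r q z"
  shows "z (Suc n) - q * z n = r ^ n * (z 1 - q * z 0)"
proof (induction n)
  case (Suc n)
  have "z (Suc (Suc n)) - q * z (Suc n) = r * (z (Suc n) - q * z n)"
    using assms by (simp add: recurrence_with_roots_def algebra_simps)
  then show ?case
    by (simp only: Suc.IH power_Suc mult.assoc)
qed simp

text \<open>Bounding the first-order recurrence, rather than using a closed form in r^n and q^n,
  covers a double root as well; the term n t^n is the price.\<close>

lemma recurrence_tendsto_0:
  fixes z :: "nat \<Rightarrow> 'a::{real_normed_field}"
  assumes rec: "recurrence_with_roots r q z"
    and "norm r < 1" "norm q < 1"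
  shows "z \<longlonglongrightarrow> 0"
proof -
  \<comment> \<open>The 1/2 keeps \<open>t\<close> positive even when both roots vanish. Dividing by
    \<open>t\<close> in \<open>K\<close> turns the forcing term into K t^(n+1), exactly the
    increment of K n t^n that the induction needs.\<close>
  define t where "t = max (1/2) (max (norm r) (norm q))"
  have t: "0 < t" "t < 1" "norm r \<le> t" "norm q \<le> t"
    using assms(2,3) by (auto simp: t_def)
  define K where "K = norm (z 1 - q * z 0) / t"
  have bound: "norm (z n) \<le> norm (z 0) * t ^ n + K * (of_nat n * t ^ n)" for n
  proof (induction n)
    case (Suc n)
    have "z (Suc n) = q * z n + r ^ n * (z 1 - q * z 0)"
      using recurrence_first_order[OF rec, of n] by (simp add: algebra_simps)
    then have "norm (z (Suc n)) \<le> norm q * norm (z n) + norm r ^ n * (K * t)"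
      using t(1) norm_triangle_ineq[of "q * z n" "r ^ n * (z 1 - q * z 0)"]
      by (simp add: K_def norm_mult norm_power)
    also have "\<dots> \<le> t * (norm (z 0) * t ^ n + K * (of_nat n * t ^ n)) + t ^ n * (K * t)"
      using t Suc.IH
      by (intro add_mono mult_mono power_mono mult_nonneg_nonneg) (auto simp: K_def)
    finally show ?case
      by (simp add: algebra_simps)
  qed simp
  have "(\<lambda>n. t ^ n) \<longlonglongrightarrow> 0" "(\<lambda>n. of_nat n * t ^ n) \<longlonglongrightarrow> 0"
    using t by (simp_all add: LIMSEQ_power_zero powser_times_n_limit_0)
  then have "(\<lambda>n. norm (z 0) * t ^ n + K * (of_nat n * t ^ n)) \<longlonglongrightarrow> norm (z 0) * 0 + K * 0"
    by (intro tendsto_add tendsto_mult tendsto_const)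
  then have lim: "(\<lambda>n. norm (z 0) * t ^ n + K * (of_nat n * t ^ n)) \<longlonglongrightarrow> 0"
    by (simp only: mult_zero_right add_0)
  have "\<forall>\<^sub>F n in sequentially. norm (z n) \<le> norm (z 0) * t ^ n + K * (of_nat n * t ^ n)"
    by (rule always_eventually) (rule allI, rule bound)
  then show ?thesis
    using lim by (rule Lim_null_comparison)
qed

text \<open>Subtracting the two first-order identities eliminates z (n+1) and expresses (r - q) z n
  through r^n and q^n. The roots differ because their moduli do, and \<open>nz\<close> says that the
  coefficient of the growing power is nonzero.\<close>

lemma recurrence_at_infinity:
  fixes z :: "nat \<Rightarrow> 'a::{real_normed_field}"
  assumes rec: "recurrence_with_roots r q z"
    and r: "1 < norm r" and q: "norm q < 1" and nz: "z 1 \<noteq> q * z 0"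
  shows "filterlim (\<lambda>n. norm (z n)) at_top sequentially"
proof -
  define w where "w = norm (z 1 - q * z 0)"
  define v where "v = norm (z 1 - r * z 0)"
  define d where "d = norm (r - q)"
  have "w > 0" "d > 0"
    using nz r q by (auto simp: w_def d_def)
  have bound: "(w * norm r ^ n + (- v)) / d \<le> norm (z n)" for n
  proof -
    have "z (Suc n) - r * z n = q ^ n * (z 1 - r * z 0)"
      using rec by (intro recurrence_first_order) (simp add: recurrence_with_roots_commute)
    moreover have "z (Suc n) - q * z n = r ^ n * (z 1 - q * z 0)"
      using rec by (rule recurrence_first_order)
    moreover have "(r - q) * z n = (z (Suc n) - q * z n) - (z (Suc n) - r * z n)"
      by (simp add: algebra_simps)
    ultimately have "(r - q) * z n = r ^ n * (z 1 - q * z 0) - q ^ n * (z 1 - r * z 0)"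
      by simp
    then have "d * norm (z n) = norm (r ^ n * (z 1 - q * z 0) - q ^ n * (z 1 - r * z 0))"
      by (simp add: d_def flip: norm_mult)
    also have "\<dots> \<ge> w * norm r ^ n - norm q ^ n * v"
      using norm_triangle_ineq2[of "r ^ n * (z 1 - q * z 0)" "q ^ n * (z 1 - r * z 0)"]
      by (simp add: w_def v_def norm_mult norm_power mult.commute)
    finally have "w * norm r ^ n - norm q ^ n * v \<le> d * norm (z n)" .
    moreover have "norm q ^ n * v \<le> 1 * v"
      using q by (intro mult_right_mono power_le_one) (auto simp: v_def)
    ultimately show ?thesis
      using \<open>d > 0\<close> by (simp add: field_simps)
  qed
  have "filterlim (\<lambda>n. norm r ^ n) at_top sequentially"
    using filterlim_at_infinity_imp_norm_at_top[OF filterlim_realpow_sequentially_gt1[OF r]]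
    by (simp add: norm_power)
  then have "filterlim (\<lambda>n. w * norm r ^ n) at_top sequentially"
    using \<open>w > 0\<close> by (intro filterlim_tendsto_pos_mult_at_top[OF tendsto_const])
  then have "filterlim (\<lambda>n. - v + w * norm r ^ n) at_top sequentially"
    by (intro filterlim_tendsto_add_at_top[OF tendsto_const])
  then have "filterlim (\<lambda>n. inverse d * (- v + w * norm r ^ n)) at_top sequentially"
    using \<open>d > 0\<close> by (intro filterlim_tendsto_pos_mult_at_top[OF tendsto_const]) auto
  then show ?thesis
    by (rule filterlim_at_top_mono)
       (use bound in \<open>auto simp: field_simps intro!: always_eventually\<close>)
qed

section \<open>Characteristic roots of the method: convergence below the threshold, divergence above
  it\<close>

lemma frb_characteristic_roots:
  fixes lam \<gamma> :: real
  obtains r q :: complex where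
    "\<And>xm x0. recurrence_with_roots r q (frb_complex \<gamma> lam xm x0)"
    "(cmod (r * q))\<^sup>2 = lam\<^sup>2 / (1 + lam\<^sup>2 * \<gamma>\<^sup>2)"
    "(1 - (cmod r)\<^sup>2) * (1 - (cmod q)\<^sup>2) * (cmod (1 - r * cnj q))\<^sup>2
      = ((1 + \<gamma>) * lam / (1 + lam\<^sup>2 * \<gamma>\<^sup>2))\<^sup>2 * (1 - lam\<^sup>2 * ((1 + \<gamma>) * (3 - \<gamma>)))"
proof -
  \<comment> \<open>\<open>a\<close> is the complex number by which I + lam A multiplies, and
    \<open>N\<close> is its squared modulus.\<close>
  define a where "a = 1 + \<i> * (lam * \<gamma>)"
  define N where "N = 1 + lam\<^sup>2 * \<gamma>\<^sup>2"
  have N: "N > 0"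
    unfolding N_def by (rule add_pos_nonneg) simp_all
  have aN: "(cmod a)\<^sup>2 = N"
    by (simp add: a_def N_def cmod_power2 power_mult_distrib)
  then have a: "a \<noteq> 0"
    using N by auto
  obtain r q where sum: "r + q = (1 - 2 * \<i> * lam) / a" and prod: "r * q = - (\<i> * lam / a)"
    by (rule quadratic_roots_exist)
  have as: "a * (r + q) = 1 - 2 * \<i> * lam" and ap: "a * (r * q) = - (\<i> * lam)"
    using a by (simp_all add: sum prod)
  \<comment> \<open>The roots come from \<open>lam\<close> and \<open>\<gamma>\<close> alone, so one
    pair serves all starting points; the subspace in \<open>frb_rotJ_diverges\<close> can therefore
    be fixed before them.\<close>
  have "recurrence_with_roots r q (frb_complex \<gamma> lam xm x0)" for xm x0
    unfolding recurrence_with_roots_def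
  proof
    fix n
    let ?z = "frb_complex \<gamma> lam xm x0"
    have "a * ?z (Suc (Suc n)) = a * (r + q) * ?z (Suc n) - a * (r * q) * ?z n"
      using frb_complex_recurrence[of lam \<gamma> xm x0 n] unfolding as ap by (simp add: a_def)
    also have "\<dots> = a * ((r + q) * ?z (Suc n) - r * q * ?z n)"
      by (simp add: algebra_simps)
    finally show "?z (Suc (Suc n)) = (r + q) * ?z (Suc n) - r * q * ?z n"
      using a by simp
  qed
  moreover have pq: "(cmod (r * q))\<^sup>2 = lam\<^sup>2 / N"
    by (simp add: prod norm_divide norm_mult power_divide aN)
  moreover have "(1 - (cmod r)\<^sup>2) * (1 - (cmod q)\<^sup>2) * (cmod (1 - r * cnj q))\<^sup>2
      = ((1 + \<gamma>) * lam / N)\<^sup>2 * (1 - lam\<^sup>2 * ((1 + \<gamma>) * (3 - \<gamma>)))"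
  proof -
    \<comment> \<open>Scaling by \<open>N\<close>, which is \<open>a * cnj a\<close>, clears every
      denominator: \<open>a\<close> cancels those of the sum and the product, \<open>cnj a\<close>
      that of the conjugated sum.\<close>
    have "a * cnj a = N"
      using aN by (simp only: complex_norm_square[symmetric] of_real_power[symmetric])
    then have "N * (r + q - r * q * cnj (r + q))
        = cnj a * (a * (r + q)) - a * (r * q) * cnj (a * (r + q))"
      by (simp add: algebra_simps flip: \<open>a * cnj a = N\<close>)
    also have "\<dots> = cnj a * (1 - 2 * \<i> * lam) + \<i> * lam * (1 + 2 * \<i> * lam)"
      unfolding as ap by simp
    also have "\<dots> = Complex (1 - 2 * lam\<^sup>2 * (1 + \<gamma>)) (- lam * (1 + \<gamma>))"
      by (simp add: a_def complex_eq_iff power2_eq_square algebra_simps)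
    finally have "N * cmod (r + q - r * q * cnj (r + q))
        = cmod (Complex (1 - 2 * lam\<^sup>2 * (1 + \<gamma>)) (- lam * (1 + \<gamma>)))"
      using N by (metis norm_mult norm_of_real abs_of_pos)
    then have "N\<^sup>2 * (cmod (r + q - r * q * cnj (r + q)))\<^sup>2
        = (1 - 2 * lam\<^sup>2 * (1 + \<gamma>))\<^sup>2 + (lam * (1 + \<gamma>))\<^sup>2"
      by (simp only: flip: power_mult_distrib) (simp add: cmod_power2 power_mult_distrib)
    moreover have "N\<^sup>2 * (1 - (cmod (r * q))\<^sup>2)\<^sup>2 = (N - lam\<^sup>2)\<^sup>2"
      unfolding pq power_mult_distrib[symmetric] using N by (simp add: algebra_simps)
    ultimately have "N\<^sup>2 * ((1 - (cmod r)\<^sup>2) * (1 - (cmod q)\<^sup>2) * (cmod (1 - r * cnj q))\<^sup>2)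
        = (N - lam\<^sup>2)\<^sup>2 - ((1 - 2 * lam\<^sup>2 * (1 + \<gamma>))\<^sup>2 + (lam * (1 + \<gamma>))\<^sup>2)"
      by (simp only: schur_cohn_identity[symmetric] right_diff_distrib[of "N\<^sup>2"])
    \<comment> \<open>The threshold polynomial arises here. As a difference of squares, the first
      two terms give ((1 + \<gamma>) lam)^2 (2 - lam^2 (1 + \<gamma>)(3 - \<gamma>)), and the third
      removes one copy of ((1 + \<gamma>) lam)^2.\<close>
    also have "\<dots> = ((1 + \<gamma>) * lam)\<^sup>2 * (1 - lam\<^sup>2 * ((1 + \<gamma>) * (3 - \<gamma>)))"
      unfolding N_def by algebra
    finally show ?thesis
      using N by (simp add: field_simps)
  qed
  ultimately show ?thesis
    by (intro that[of r q]) (simp_all add: N_def)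
qed

text \<open>Positivity in the Schur-Cohn identity only puts both roots strictly on the same side of
  the unit circle; that their product has modulus below 1 rules out the outside.\<close>

lemma frb_rotJ_tendsto_0:
  fixes lam \<gamma> :: real
  assumes "lam > 0" "\<gamma> \<ge> 0" and small: "lam\<^sup>2 * ((1 + \<gamma>) * (3 - \<gamma>)) < 1"
  shows "frb (\<lambda>x. \<gamma> *\<^sub>R rotJ x) rotJ lam xm x0 \<longlonglongrightarrow> 0"
proof -
  obtain r q :: complex where
    rec: "\<And>xm x0. recurrence_with_roots r q (frb_complex \<gamma> lam xm x0)" and
    prod: "(cmod (r * q))\<^sup>2 = lam\<^sup>2 / (1 + lam\<^sup>2 * \<gamma>\<^sup>2)" and
    sc: "(1 - (cmod r)\<^sup>2) * (1 - (cmod q)\<^sup>2) * (cmod (1 - r * cnj q))\<^sup>2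
      = ((1 + \<gamma>) * lam / (1 + lam\<^sup>2 * \<gamma>\<^sup>2))\<^sup>2 * (1 - lam\<^sup>2 * ((1 + \<gamma>) * (3 - \<gamma>)))"
    by (rule frb_characteristic_roots[where \<gamma> = \<gamma> and lam = lam]) blast
  have N: "1 + lam\<^sup>2 * \<gamma>\<^sup>2 > 0"
    by (rule add_pos_nonneg) simp_all
  \<comment> \<open>Equivalently lam^2 (1 + \<gamma>)(1 - \<gamma>) < 1. For \<gamma> < 1 this
    follows from \<open>small\<close> since 1 - \<gamma> is below 3 - \<gamma>; otherwise the left
    side is not positive.\<close>
  have "lam\<^sup>2 < 1 + lam\<^sup>2 * \<gamma>\<^sup>2"
  proof (cases "\<gamma> < 1")
    case True
    have "lam\<^sup>2 * ((1 + \<gamma>) * (1 - \<gamma>)) \<le> lam\<^sup>2 * ((1 + \<gamma>) * (3 - \<gamma>))"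
      using assms(2) by (intro mult_left_mono) auto
    then show ?thesis
      using small by (simp add: algebra_simps power2_eq_square)
  next
    case False
    then have "lam\<^sup>2 * 1 \<le> lam\<^sup>2 * \<gamma>\<^sup>2"
      by (intro mult_left_mono) (auto simp: one_le_power)
    then show ?thesis
      by simp
  qed
  then have "(cmod r)\<^sup>2 * (cmod q)\<^sup>2 < 1"
    using prod N by (simp add: norm_mult power_mult_distrib)
  then have not_both: "\<not> (1 \<le> (cmod r)\<^sup>2 \<and> 1 \<le> (cmod q)\<^sup>2)"
    using mult_mono[of 1 "(cmod r)\<^sup>2" 1 "(cmod q)\<^sup>2"] by auto
  have "((1 + \<gamma>) * lam / (1 + lam\<^sup>2 * \<gamma>\<^sup>2))\<^sup>2 > 0"
    using N assms by (intro zero_less_power divide_pos_pos mult_pos_pos) auto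
  then have "(1 - (cmod r)\<^sup>2) * (1 - (cmod q)\<^sup>2) * (cmod (1 - r * cnj q))\<^sup>2 > 0"
    unfolding sc using small by (intro mult_pos_pos) auto
  then have "(1 - (cmod r)\<^sup>2) * (1 - (cmod q)\<^sup>2) > 0"
    by (simp add: zero_less_mult_iff)
  then have "(cmod r)\<^sup>2 < 1" "(cmod q)\<^sup>2 < 1"
    using not_both by (auto simp: zero_less_mult_iff)
  then have "cmod r < 1" "cmod q < 1"
    by (simp_all add: abs_square_less_1)
  then have "frb_complex \<gamma> lam xm x0 \<longlonglongrightarrow> 0"
    by (rule recurrence_tendsto_0[OF rec])
  then show ?thesis
    by (subst (asm) tendsto_norm_zero_iff[symmetric])
       (simp only: norm_frb_complex tendsto_norm_zero_iff)
qed

text \<open>A negative Schur-Cohn value puts exactly one root outside the closed disc and the other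
  inside the open one. An exceptional subspace is unavoidable: if x_0 = q x_{-1} with q the inner
  root, the iterates follow powers of q and tend to 0.\<close>

lemma frb_rotJ_diverges:
  fixes lam \<gamma> :: real
  assumes "lam > 0" "\<gamma> \<ge> 0" and large: "lam\<^sup>2 * ((1 + \<gamma>) * (3 - \<gamma>)) > 1"
  shows "\<exists>S :: ((real^2) \<times> (real^2)) set. subspace S \<and> S \<noteq> UNIV \<and>
            (\<forall>xm x0. (xm, x0) \<notin> S \<longrightarrow>
               filterlim (frb (\<lambda>x. \<gamma> *\<^sub>R rotJ x) rotJ lam xm x0) at_infinity sequentially)"
proof -
  \<comment> \<open>Proved for generic \<open>r\<close> and \<open>q\<close>, since it is not known
    which of the two obtained roots is the outer one.\<close>
  have main: ?thesis
    if rec: "\<And>xm x0. recurrence_with_roots r q (frb_complex \<gamma> lam xm x0)"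
      and r: "1 < cmod r" and q: "cmod q < 1" for r q
  proof (intro exI conjI allI impI)
    let ?S = "{u. complex_of_vec (snd u) = q * complex_of_vec (fst u)}"
    show "subspace ?S"
      by (auto simp: subspace_def linear_0[OF linear_complex_of_vec]
          linear_add[OF linear_complex_of_vec] linear_scale[OF linear_complex_of_vec] algebra_simps)
    \<comment> \<open>With x_{-1} = 0, membership would force x_0 = 0 whatever \<open>q\<close>
      is.\<close>
    have "(0, axis 1 1) \<notin> ?S"
      by (simp add: linear_0[OF linear_complex_of_vec] complex_of_vec_def complex_eq_iff)
    then show "?S \<noteq> UNIV"
      by blast
    fix xm x0 :: "real^2" assume "(xm, x0) \<notin> ?S"
    then have "filterlim (\<lambda>n. cmod (frb_complex \<gamma> lam xm x0 n)) at_top sequentially"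
      by (intro recurrence_at_infinity[OF rec r q]) (simp add: frb_complex_def)
    then show "filterlim (frb (\<lambda>x. \<gamma> *\<^sub>R rotJ x) rotJ lam xm x0) at_infinity sequentially"
      by (simp add: norm_frb_complex filterlim_norm_at_top_imp_at_infinity)
  qed
  obtain r q :: complex where
    rec: "\<And>xm x0. recurrence_with_roots r q (frb_complex \<gamma> lam xm x0)" and
    sc: "(1 - (cmod r)\<^sup>2) * (1 - (cmod q)\<^sup>2) * (cmod (1 - r * cnj q))\<^sup>2
      = ((1 + \<gamma>) * lam / (1 + lam\<^sup>2 * \<gamma>\<^sup>2))\<^sup>2 * (1 - lam\<^sup>2 * ((1 + \<gamma>) * (3 - \<gamma>)))"
    by (rule frb_characteristic_roots[where \<gamma> = \<gamma> and lam = lam]) blast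
  have "1 + lam\<^sup>2 * \<gamma>\<^sup>2 > 0"
    by (rule add_pos_nonneg) simp_all
  then have "((1 + \<gamma>) * lam / (1 + lam\<^sup>2 * \<gamma>\<^sup>2))\<^sup>2 > 0"
    using assms by (intro zero_less_power divide_pos_pos mult_pos_pos) auto
  then have "(1 - (cmod r)\<^sup>2) * (1 - (cmod q)\<^sup>2) * (cmod (1 - r * cnj q))\<^sup>2 < 0"
    unfolding sc using large by (intro mult_pos_neg) auto
  then have "(1 - (cmod r)\<^sup>2) * (1 - (cmod q)\<^sup>2) < 0"
    by (simp add: mult_less_0_iff)
  then have "1 < (cmod r)\<^sup>2 \<and> (cmod q)\<^sup>2 < 1 \<or> 1 < (cmod q)\<^sup>2 \<and> (cmod r)\<^sup>2 < 1"
    by (auto simp: mult_less_0_iff)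
  then consider "1 < cmod r" "cmod q < 1" | "1 < cmod q" "cmod r < 1"
    by (auto simp: abs_square_less_1 power2_gt_1_iff)
  then show ?thesis
  proof cases
    case 1
    then show ?thesis by (rule main[OF rec])
  next
    case 2
    then show ?thesis
      using rec by (intro main[of q r]) (simp_all add: recurrence_with_roots_commute)
  qed
qed

section \<open>The threshold as a polynomial condition on the step size, and its minimum\<close>

lemma less_inverse_sqrt_iff:
  fixes x d :: real
  assumes "x > 0" "d > 0"
  shows "x < 1 / sqrt d \<longleftrightarrow> x\<^sup>2 * d < 1"
proof -
  have "x < 1 / sqrt d \<longleftrightarrow> x * sqrt d < 1"
    using assms by (simp add: field_simps)
  also have "\<dots> \<longleftrightarrow> (x * sqrt d)\<^sup>2 < 1"
    using assms by (simp add: abs_square_less_1)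
  finally show ?thesis
    using assms by (simp add: power_mult_distrib)
qed

lemma inverse_sqrt_less_iff:
  fixes x d :: real
  assumes "x > 0" "d > 0"
  shows "1 / sqrt d < x \<longleftrightarrow> 1 < x\<^sup>2 * d"
proof -
  have "1 / sqrt d < x \<longleftrightarrow> 1 < x * sqrt d"
    using assms by (simp add: field_simps)
  also have "\<dots> \<longleftrightarrow> 1 < (x * sqrt d)\<^sup>2"
    using assms by (simp add: power2_gt_1_iff)
  finally show ?thesis
    using assms by (simp add: power_mult_distrib)
qed

text \<open>For \<gamma> at least 3 the factor 3 - \<gamma> is not positive, so the polynomial
  condition holds for every step size, in agreement with the infinite threshold.\<close>

lemma less_lambda_starD:
  assumes "lam > 0" "\<gamma> \<ge> 0" "ereal lam < lambda_star 1 \<gamma>"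
  shows "lam\<^sup>2 * ((1 + \<gamma>) * (3 - \<gamma>)) < 1"
proof (cases "\<gamma> < 3")
  case True
  then show ?thesis
    using assms less_inverse_sqrt_iff[of lam "(1 + \<gamma>) * (3 - \<gamma>)"]
    by (simp add: lambda_star_def)
next
  case False
  then have "lam\<^sup>2 * ((1 + \<gamma>) * (3 - \<gamma>)) \<le> 0"
    using assms(2) by (intro mult_nonneg_nonpos) auto
  then show ?thesis
    by simp
qed

text \<open>A finite step size above the threshold forces \<gamma> < 3, so the square root formula
  always applies.\<close>

lemma lambda_star_lessD:
  assumes "lam > 0" "\<gamma> \<ge> 0" "lambda_star 1 \<gamma> < ereal lam"
  shows "1 < lam\<^sup>2 * ((1 + \<gamma>) * (3 - \<gamma>))"
  using assms inverse_sqrt_less_iff[of lam "(1 + \<gamma>) * (3 - \<gamma>)"]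
  by (auto simp: lambda_star_def split: if_splits)

lemma lambda_star_1: "lambda_star 1 1 = ereal (1 / 2)"
  by (simp add: lambda_star_def)

text \<open>Completing the square, (1 + \<gamma>)(3 - \<gamma>) = 4 - (\<gamma> - 1)^2 is at most 4,
  with equality at \<gamma> = 1.\<close>

lemma lambda_star_ge:
  assumes "\<gamma> \<ge> 0"
  shows "ereal (1 / 2) \<le> lambda_star 1 \<gamma>"
proof (cases "\<gamma> < 3")
  case True
  have "(1 + \<gamma>) * (3 - \<gamma>) = 4 - (\<gamma> - 1)\<^sup>2"
    by (simp add: power2_eq_square algebra_simps)
  then have "sqrt ((1 + \<gamma>) * (3 - \<gamma>)) \<le> sqrt 4"
    by (intro real_sqrt_le_mono) simp
  moreover have "sqrt ((1 + \<gamma>) * (3 - \<gamma>)) > 0"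
    using assms True by simp
  ultimately show ?thesis
    using True by (simp add: lambda_star_def field_simps)
qed (simp add: lambda_star_def)

theorem theorem2:
  "lipschitz_const rotJ = 1 \<and>
   (\<forall>\<gamma>\<ge>0.
      {x. 0 = \<gamma> *\<^sub>R rotJ x + rotJ x} = {0} \<and>
      (\<forall>lam::real. 0 < lam \<and> ereal lam < lambda_star (lipschitz_const rotJ) \<gamma> \<longrightarrow>
         (\<forall>xm x0. frb (\<lambda>x. \<gamma> *\<^sub>R rotJ x) rotJ lam xm x0 \<longlonglongrightarrow> 0)) \<and>
      (\<forall>lam::real. 0 < lam \<and> lambda_star (lipschitz_const rotJ) \<gamma> < ereal lam \<longrightarrow>
         (\<exists>S :: ((real^2) \<times> (real^2)) set. subspace S \<and> S \<noteq> UNIV \<and>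
            (\<forall>xm x0. (xm, x0) \<notin> S \<longrightarrow>
               filterlim (frb (\<lambda>x. \<gamma> *\<^sub>R rotJ x) rotJ lam xm x0) at_infinity sequentially)))) \<and>
   lambda_star (lipschitz_const rotJ) 0 = ereal (1 / sqrt 3) \<and>
   lambda_star (lipschitz_const rotJ) 1 = ereal (1 / 2) \<and>
   (\<forall>\<gamma>\<ge>0. lambda_star (lipschitz_const rotJ) 1 \<le> lambda_star (lipschitz_const rotJ) \<gamma>) \<and>
   lambda_star (lipschitz_const rotJ) 2 = ereal (1 / sqrt 3)"
  unfolding lipschitz_const_rotJ
proof (intro conjI allI impI)
  fix \<gamma> :: real assume \<gamma>: "\<gamma> \<ge> 0"
  show "{x. 0 = \<gamma> *\<^sub>R rotJ x + rotJ x} = {0}"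
    using \<gamma> by (rule rotJ_zeros)
  show "lambda_star 1 1 \<le> lambda_star 1 \<gamma>"
    unfolding lambda_star_1 using \<gamma> by (rule lambda_star_ge)
  fix lam :: real
  show "frb (\<lambda>x. \<gamma> *\<^sub>R rotJ x) rotJ lam xm x0 \<longlonglongrightarrow> 0"
    if "0 < lam \<and> ereal lam < lambda_star 1 \<gamma>" for xm x0
    using that \<gamma> by (intro frb_rotJ_tendsto_0 less_lambda_starD) auto
  show "\<exists>S :: ((real^2) \<times> (real^2)) set. subspace S \<and> S \<noteq> UNIV \<and>
            (\<forall>xm x0. (xm, x0) \<notin> S \<longrightarrow>
               filterlim (frb (\<lambda>x. \<gamma> *\<^sub>R rotJ x) rotJ lam xm x0) at_infinity sequentially)"
    if "0 < lam \<and> lambda_star 1 \<gamma> < ereal lam"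
    using that \<gamma> by (intro frb_rotJ_diverges lambda_star_lessD) auto
qed (simp_all add: lambda_star_def)

end
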